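(* Let $\mathcal L$ be a FOLDS signature category, let $\mathcal M$ be a model category and let $D\colon\mathcal L^{\mathrm{op}}\to\mathcal M$ be a diagram satisfying Condition $\bigtriangleup$ and such that $M_X:=\mathrm{Hom}_{\mathcal M}(D(-),X)$ is an $\mathcal L$-structure for every object $X$ of $\mathcal M$. Let $f\colon X\to Y$ be a weak equivalence between fibrant objects of $\mathcal M$. Let $\Gamma$ be a context together with two interpretations $\alpha\colon\Gamma\to M_X$ and $\beta\colon\Gamma\to M_Y$ that are compatible with the map $M_f\colon M_X\to M_Y$, i.e. $M_f\circ\alpha=\beta$. Then for every formula $\phi$ with $\mathrm{var}(\phi)\subset\Gamma$, $M_X\vDash\phi[\alpha]$ if and only if $M_Y\vDash\phi[\beta]$.
   Context: **FOLDS.** A FOLDS signature is a category $\mathcal L$ with a functor $\deg\colon\mathcal L\to\omega^{\mathrm{op}}$ reflecting identities, such that each object is the domain of only finitely many morphisms, together with a distinguished set of maximal objects, called relation symbols and written with a dot; its objects are called kinds. For $M\colon\mathcal L\to\mathrm{Set}$ and a kind $K$, the matching object $\partial^KM$ is the set of families $(m_p)$ indexed by the non-identity morphisms $p\colon K\to K_p$, with $m_p\in MK_p$ and $M(q)(m_p)=m_{qp}$ for all $q\colon K_p\to K_{qp}$; the matching map is $MK\to\partial^KM$, $m\mapsto(M(p)(m))_p$. An $\mathcal L$-structure is a functor $M\colon\mathcal L\to\mathrm{Set}$ such that $M\dot R\to\prod_{p\colon\dot R\to K_p,\,p\ne\mathrm{id}}MK_p$ is injective for each relation symbol $\dot R$.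 A context is an $\mathcal L$-structure $\Gamma$ with the sets $\Gamma K$ pairwise disjoint. Its elements are variables. For $\langle x_p\rangle\in\partial^K\Gamma$ (a compatible family), the sort $K\langle x_p\rangle$ has as variables the elements $x$ of the fibre of $\Gamma K\to\partial^K\Gamma$ over $\langle x_p\rangle$ (written $x:K\langle x_p\rangle$); $x$ depends on the $x_p$, and $\mathrm{dep}(x)$ is the set of these. Formulae $\phi$ and their sets $\mathrm{var}(\phi)$ of free variables (variables being taken from a context) are defined recursively: atomic formulae $\dot R\langle x_p\rangle$, for $\dot R$ a relation symbol and $\langle x_p\rangle$ a compatible family, with $\mathrm{var}=\{x_p\}$; $\top,\bot$ with $\mathrm{var}=\emptyset$; $\phi\wedge\psi$, $\phi\vee\psi$, $\phi\to\psi$ with $\mathrm{var}=\mathrm{var}(\phi)\cup\mathrm{var}(\psi)$; and $\forall x\phi$, $\exists x\phi$ whenever no variable in $\mathrm{var}(\phi)$ depends on $x$ ($x\in\mathrm{var}(\phi)$ is allowed), with $\mathrm{var}=(\mathrm{var}(\phi)\setminus\{x\})\cup\mathrm{dep}(x)$. Each $\mathrm{var}(\phi)$ is itself a context. An interpretation (evaluation) of a context $\Gamma$ in an $\mathcal L$-structure $M$ is a natural transformation $\alpha\colon\Gamma\to M$; if $\mathrm{var}(\phi)\subset\Gamma$, it restricts to $\mathrm{var}(\phi)$, and $M\vDash\phi[\alpha]$ is defined by: $M\vDash\dot R\langle x_p\rangle[\alpha]$ iff $\langle\alpha x_p\rangle$ lies in the subset $M\dot R\subset\prod_pMK_p$;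 $\top$ always holds, $\bot$ never; $\wedge,\vee,\to$ are interpreted classically; for $x:K\langle x_p\rangle$, $M\vDash\forall x\phi[\alpha]$ (resp. $\exists x\phi$) iff for all (resp. some) $a\in MK$ in the fibre of $MK\to\partial^KM$ over $\langle\alpha x_p\rangle$, $M\vDash\phi[\alpha']$ where $\alpha'$ agrees with $\alpha$ on variables other than $x$ and sends $x$ to $a$. **Condition $\bigtriangleup$.** A natural transformation $\rho\colon M\to N$ in $\mathrm{Set}^{\mathcal L}$ is fiberwise surjective if for every kind $K$ the induced map $M(K)\to N(K)\times_{\partial^KN}\partial^KM$ is surjective. Monomorphisms and fiberwise surjections form the left and right classes of the Reedy weak factorization system on $\mathrm{Set}^{\mathcal L}$ induced by (monomorphisms, epimorphisms) on $\mathrm{Set}$. Condition $\bigtriangleup$ on $D\colon\mathcal L^{\mathrm{op}}\to\mathcal M$ says that the weak factorization system (cofibrations, trivial fibrations) of $\mathcal M$ is right-lifted from this one along the functor $N=\mathrm{Hom}_{\mathcal M}(D(-),-)\colon\mathcal M\to\mathrm{Set}^{\mathcal L}$ (which has left adjoint the left Kan extension of $D$ along the Yoneda embedding); i.e. a morphism $g$ of $\mathcal M$ is a trivial fibration if and only if $\mathrm{Hom}_{\mathcal M}(D(-),g)$ is fiberwise surjective. Model categories are assumed complete and cocomplete. *)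

theory Defs
  imports Main "HOL-Library.FuncSet"
begin

unbundle cardinal_syntax

text \<open>\<open>Comp C g f\<close> is the composite of \<open>f\<close> followed by \<open>g\<close>; its value is irrelevant when
  \<open>Cod C f \<noteq> Dom C g\<close>.\<close>

record ('o, 'a) cat =
  Obj :: "'o set"
  Arr :: "'a set"
  Dom :: "'a \<Rightarrow> 'o"
  Cod :: "'a \<Rightarrow> 'o"
  Ide :: "'o \<Rightarrow> 'a"
  Comp :: "'a \<Rightarrow> 'a \<Rightarrow> 'a"

definition hom :: "('o, 'a) cat \<Rightarrow> 'o \<Rightarrow> 'o \<Rightarrow> 'a set" where
  "hom C X Y = {f \<in> Arr C. Dom C f = X \<and> Cod C f = Y}"

locale category =
  fixes C :: "('o, 'a) cat"
  assumes Dom_Obj: "f \<in> Arr C \<Longrightarrow> Dom C f \<in> Obj C"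
    and Cod_Obj: "f \<in> Arr C \<Longrightarrow> Cod C f \<in> Obj C"
    and Ide_hom: "X \<in> Obj C \<Longrightarrow> Ide C X \<in> hom C X X"
    and Comp_hom: "\<lbrakk>f \<in> hom C X Y; g \<in> hom C Y Z\<rbrakk> \<Longrightarrow> Comp C g f \<in> hom C X Z"
    and Comp_Ide: "f \<in> hom C X Y \<Longrightarrow> Comp C f (Ide C X) = f"
    and Ide_Comp: "f \<in> hom C X Y \<Longrightarrow> Comp C (Ide C Y) f = f"
    and Comp_assoc: "\<lbrakk>f \<in> hom C X Y; g \<in> hom C Y Z; h \<in> hom C Z W\<rbrakk> \<Longrightarrow>
      Comp C h (Comp C g f) = Comp C (Comp C h g) f"

definition op_cat :: "('o, 'a) cat \<Rightarrow> ('o, 'a) cat" where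
  "op_cat C = \<lparr>Obj = Obj C, Arr = Arr C, Dom = Cod C, Cod = Dom C, Ide = Ide C,
     Comp = (\<lambda>g f. Comp C f g)\<rparr>"

record ('k, 'l, 'o, 'a) fctr =
  OMap :: "'k \<Rightarrow> 'o"
  AMap :: "'l \<Rightarrow> 'a"

locale is_functor =
  fixes J :: "('k, 'l) cat" and C :: "('o, 'a) cat" and F :: "('k, 'l, 'o, 'a) fctr"
  assumes OMap_Obj: "j \<in> Obj J \<Longrightarrow> OMap F j \<in> Obj C"
    and AMap_hom: "p \<in> hom J j k \<Longrightarrow> AMap F p \<in> hom C (OMap F j) (OMap F k)"
    and AMap_Ide: "j \<in> Obj J \<Longrightarrow> AMap F (Ide J j) = Ide C (OMap F j)"
    and AMap_Comp: "\<lbrakk>p \<in> hom J i j; q \<in> hom J j k\<rbrakk> \<Longrightarrow>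
      AMap F (Comp J q p) = Comp C (AMap F q) (AMap F p)"

definition terminal :: "('o, 'a) cat \<Rightarrow> 'o \<Rightarrow> bool" where
  "terminal C T \<longleftrightarrow> T \<in> Obj C \<and> (\<forall>X\<in>Obj C. \<exists>!t. t \<in> hom C X T)"


definition cone :: "('k, 'l) cat \<Rightarrow> ('o, 'a) cat \<Rightarrow> ('k, 'l, 'o, 'a) fctr \<Rightarrow> 'o \<Rightarrow> ('k \<Rightarrow> 'a) \<Rightarrow> bool" where
  "cone J C F X c \<longleftrightarrow> X \<in> Obj C \<and> (\<forall>j\<in>Obj J. c j \<in> hom C X (OMap F j)) \<and>
     (\<forall>p\<in>Arr J. Comp C (AMap F p) (c (Dom J p)) = c (Cod J p))"

definition limit_cone :: "('k, 'l) cat \<Rightarrow> ('o, 'a) cat \<Rightarrow> ('k, 'l, 'o, 'a) fctr \<Rightarrow> 'o \<Rightarrow> ('k \<Rightarrow> 'a) \<Rightarrow> bool" where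
  "limit_cone J C F X c \<longleftrightarrow> cone J C F X c \<and>
     (\<forall>Y d. cone J C F Y d \<longrightarrow>
        (\<exists>!u. u \<in> hom C Y X \<and> (\<forall>j\<in>Obj J. Comp C (c j) u = d j)))"

text \<open>The type \<open>'u\<close> fixes the universe relative to which ``small'' is understood: a set is small
  if its cardinality is strictly below that of \<open>'u\<close>. When \<open>'u\<close> has inaccessible cardinality this is
  smallness in the sense of a Grothendieck universe. Up to isomorphism, every small category has its
  objects and arrows in \<open>'u\<close>. The type \<open>'a\<close> of arrows of the category is not used as the universe,
  since a category with all products indexed by its own set of arrows is a preorder.\<close>

definition small_category :: "('u, 'u) cat \<Rightarrow> bool" where
  "small_category J \<longleftrightarrow> category J \<and>
     |Obj J| <o |UNIV :: 'u set| \<and> |Arr J| <o |UNIV :: 'u set|"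

definition complete :: "'u itself \<Rightarrow> ('o, 'a) cat \<Rightarrow> bool" where
  "complete (_ :: 'u itself) C \<longleftrightarrow>
     (\<forall>(J :: ('u, 'u) cat) F. small_category J \<and> is_functor J C F \<longrightarrow>
        (\<exists>X c. limit_cone J C F X c))"

definition cocomplete :: "'u itself \<Rightarrow> ('o, 'a) cat \<Rightarrow> bool" where
  "cocomplete U C \<longleftrightarrow> complete U (op_cat C)"


definition lifts :: "('o, 'a) cat \<Rightarrow> 'a \<Rightarrow> 'a \<Rightarrow> bool" where
  "lifts C i p \<longleftrightarrow>
     (\<forall>u \<in> hom C (Dom C i) (Dom C p). \<forall>v \<in> hom C (Cod C i) (Cod C p).
        Comp C p u = Comp C v i \<longrightarrow>
        (\<exists>h \<in> hom C (Cod C i) (Dom C p). Comp C h i = u \<and> Comp C p h = v))"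

locale weak_factorization_system =
  fixes C :: "('o, 'a) cat" and A B :: "'a set"
  assumes left_class: "A = {i \<in> Arr C. \<forall>p\<in>B. lifts C i p}"
    and right_class: "B = {p \<in> Arr C. \<forall>i\<in>A. lifts C i p}"
    and factorization: "f \<in> Arr C \<Longrightarrow>
      \<exists>i\<in>A. \<exists>p\<in>B. Cod C i = Dom C p \<and> f = Comp C p i"

locale model_category = category C
  for C :: "('o, 'a) cat" +
  fixes U :: "'u itself" and W Cof Fib :: "'a set"
  assumes complete: "complete U C"
    and cocomplete: "cocomplete U C"
    and W_Arr: "W \<subseteq> Arr C"
    and W_comp: "\<lbrakk>f \<in> hom C X Y; g \<in> hom C Y Z; f \<in> W; g \<in> W\<rbrakk> \<Longrightarrow> Comp C g f \<in> W"
    and W_cancel_left: "\<lbrakk>f \<in> hom C X Y; g \<in> hom C Y Z; g \<in> W; Comp C g f \<in> W\<rbrakk> \<Longrightarrow> f \<in> W"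
    and W_cancel_right: "\<lbrakk>f \<in> hom C X Y; g \<in> hom C Y Z; f \<in> W; Comp C g f \<in> W\<rbrakk> \<Longrightarrow> g \<in> W"
    and wfs_cof_trivfib: "weak_factorization_system C Cof (Fib \<inter> W)"
    and wfs_trivcof_fib: "weak_factorization_system C (Cof \<inter> W) Fib"

definition fibrant :: "('o, 'a) cat \<Rightarrow> 'a set \<Rightarrow> 'o \<Rightarrow> bool" where
  "fibrant C Fib X \<longleftrightarrow> (\<exists>T t. terminal C T \<and> t \<in> hom C X T \<and> t \<in> Fib)"


text \<open>Since the target of the degree functor is the poset of natural numbers with reversed order,
  the functor is determined by its object part, and it reflects identities iff an arrow whose
  domain and codomain have equal degree is an identity. An object is maximal if only its identity
  arrow points to it.\<close>

locale folds_signature = category L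
  for L :: "('k, 'l) cat" +
  fixes deg :: "'k \<Rightarrow> nat" and Rels :: "'k set"
  assumes deg_functor: "p \<in> Arr L \<Longrightarrow> deg (Dom L p) \<ge> deg (Cod L p)"
    and deg_reflects_ide: "\<lbrakk>p \<in> Arr L; deg (Dom L p) = deg (Cod L p)\<rbrakk> \<Longrightarrow> p = Ide L (Dom L p)"
    and finite_out: "K \<in> Obj L \<Longrightarrow> finite {p \<in> Arr L. Dom L p = K}"
    and Rels_Obj: "Rels \<subseteq> Obj L"
    and Rels_maximal: "\<lbrakk>R \<in> Rels; p \<in> Arr L; Cod L p = R\<rbrakk> \<Longrightarrow> p = Ide L R"

text \<open>A set-valued functor sends an arrow \<open>p\<close> to a function of which only the values on the set
  \<open>OMap M (Dom L p)\<close> are relevant.\<close>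

type_synonym ('k, 'l, 'e) setfctr = "('k, 'l, 'e set, 'e \<Rightarrow> 'e) fctr"

locale set_functor =
  fixes L :: "('k, 'l) cat" and M :: "('k, 'l, 'e) setfctr"
  assumes act_in: "\<lbrakk>p \<in> hom L J K; x \<in> OMap M J\<rbrakk> \<Longrightarrow> AMap M p x \<in> OMap M K"
    and act_Ide: "\<lbrakk>K \<in> Obj L; x \<in> OMap M K\<rbrakk> \<Longrightarrow> AMap M (Ide L K) x = x"
    and act_Comp: "\<lbrakk>p \<in> hom L I J; q \<in> hom L J K; x \<in> OMap M I\<rbrakk> \<Longrightarrow>
      AMap M (Comp L q p) x = AMap M q (AMap M p x)"

definition nat_trans ::
  "('k, 'l) cat \<Rightarrow> ('k, 'l, 'e) setfctr \<Rightarrow> ('k, 'l, 'f) setfctr \<Rightarrow> ('k \<Rightarrow> 'e \<Rightarrow> 'f) \<Rightarrow> bool" where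
  "nat_trans L M N \<rho> \<longleftrightarrow>
     (\<forall>K\<in>Obj L. \<rho> K \<in> OMap M K \<rightarrow> OMap N K) \<and>
     (\<forall>p\<in>Arr L. \<forall>x\<in>OMap M (Dom L p).
        \<rho> (Cod L p) (AMap M p x) = AMap N p (\<rho> (Dom L p) x))"

definition proper_arrs :: "('k, 'l) cat \<Rightarrow> 'k \<Rightarrow> 'l set" where
  "proper_arrs L K = {p \<in> Arr L. Dom L p = K \<and> p \<noteq> Ide L K}"

definition matching_object :: "('k, 'l) cat \<Rightarrow> ('k, 'l, 'e) setfctr \<Rightarrow> 'k \<Rightarrow> ('l \<Rightarrow> 'e) set" where
  "matching_object L M K =
     {m \<in> (\<Pi>\<^sub>E p\<in>proper_arrs L K. OMap M (Cod L p)).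
        \<forall>p\<in>proper_arrs L K. \<forall>q\<in>Arr L. Dom L q = Cod L p \<longrightarrow> AMap M q (m p) = m (Comp L q p)}"

definition matching_map :: "('k, 'l) cat \<Rightarrow> ('k, 'l, 'e) setfctr \<Rightarrow> 'k \<Rightarrow> 'e \<Rightarrow> 'l \<Rightarrow> 'e" where
  "matching_map L M K m = (\<lambda>p\<in>proper_arrs L K. AMap M p m)"

definition matching_trans :: "('k, 'l) cat \<Rightarrow> ('k \<Rightarrow> 'e \<Rightarrow> 'f) \<Rightarrow> 'k \<Rightarrow> ('l \<Rightarrow> 'e) \<Rightarrow> 'l \<Rightarrow> 'f" where
  "matching_trans L \<rho> K m = (\<lambda>p\<in>proper_arrs L K. \<rho> (Cod L p) (m p))"

definition fiberwise_surjective ::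
  "('k, 'l) cat \<Rightarrow> ('k, 'l, 'e) setfctr \<Rightarrow> ('k, 'l, 'f) setfctr \<Rightarrow> ('k \<Rightarrow> 'e \<Rightarrow> 'f) \<Rightarrow> bool" where
  "fiberwise_surjective L M N \<rho> \<longleftrightarrow> nat_trans L M N \<rho> \<and>
     (\<forall>K\<in>Obj L. (\<lambda>x. (\<rho> K x, matching_map L M K x)) ` OMap M K =
        {(n, m). n \<in> OMap N K \<and> m \<in> matching_object L M K \<and>
                 matching_map L N K n = matching_trans L \<rho> K m})"

locale L_structure = set_functor L M
  for L :: "('k, 'l) cat" and Rels :: "'k set" and M :: "('k, 'l, 'e) setfctr" +
  assumes rel_inj: "R \<in> Rels \<Longrightarrow> inj_on (matching_map L M R) (OMap M R)"

locale context_structure = L_structure L Rels G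
  for L :: "('k, 'l) cat" and Rels :: "'k set" and G :: "('k, 'l, 'v) setfctr" +
  assumes disjoint_kinds:
    "\<lbrakk>J \<in> Obj L; K \<in> Obj L; J \<noteq> K\<rbrakk> \<Longrightarrow> OMap G J \<inter> OMap G K = {}"

definition restrict_to :: "('k, 'l, 'e) setfctr \<Rightarrow> 'e set \<Rightarrow> ('k, 'l, 'e) setfctr" where
  "restrict_to M V = \<lparr>OMap = (\<lambda>K. OMap M K \<inter> V), AMap = AMap M\<rparr>"

definition subfunctor :: "('k, 'l) cat \<Rightarrow> ('k, 'l, 'e) setfctr \<Rightarrow> ('k, 'l, 'e) setfctr \<Rightarrow> bool" where
  "subfunctor L M N \<longleftrightarrow> (\<forall>K\<in>Obj L. OMap M K \<subseteq> OMap N K) \<and>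
     (\<forall>p\<in>Arr L. \<forall>x\<in>OMap M (Dom L p). AMap M p x = AMap N p x)"


text \<open>Quantifiers carry the kind of the bound variable. The variables of a formula, bound ones
  included, are taken from an ambient context \<open>\<Delta>\<close>, which determines their sorts. A formula may be
  evaluated in any context \<open>\<Gamma>\<close> containing its free variables: the bound variables need not belong
  to \<open>\<Gamma>\<close>.\<close>

datatype ('k, 'l, 'v) formula =
    Atom 'k "'l \<Rightarrow> 'v"
  | Top
  | Bot
  | Conj "('k, 'l, 'v) formula" "('k, 'l, 'v) formula"
  | Disj "('k, 'l, 'v) formula" "('k, 'l, 'v) formula"
  | Imp "('k, 'l, 'v) formula" "('k, 'l, 'v) formula"
  | All 'k 'v "('k, 'l, 'v) formula"
  | Exi 'k 'v "('k, 'l, 'v) formula"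

definition dep :: "('k, 'l) cat \<Rightarrow> ('k, 'l, 'v) setfctr \<Rightarrow> 'v \<Rightarrow> 'v set" where
  "dep L \<Delta> x = {AMap \<Delta> p x | K p. K \<in> Obj L \<and> x \<in> OMap \<Delta> K \<and> p \<in> proper_arrs L K}"

primrec var :: "('k, 'l) cat \<Rightarrow> ('k, 'l, 'v) setfctr \<Rightarrow> ('k, 'l, 'v) formula \<Rightarrow> 'v set" where
  "var L \<Delta> (Atom R xs) = xs ` proper_arrs L R"
| "var L \<Delta> Top = {}"
| "var L \<Delta> Bot = {}"
| "var L \<Delta> (Conj \<phi> \<psi>) = var L \<Delta> \<phi> \<union> var L \<Delta> \<psi>"
| "var L \<Delta> (Disj \<phi> \<psi>) = var L \<Delta> \<phi> \<union> var L \<Delta> \<psi>"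
| "var L \<Delta> (Imp \<phi> \<psi>) = var L \<Delta> \<phi> \<union> var L \<Delta> \<psi>"
| "var L \<Delta> (All K x \<phi>) = (var L \<Delta> \<phi> - {x}) \<union> dep L \<Delta> x"
| "var L \<Delta> (Exi K x \<phi>) = (var L \<Delta> \<phi> - {x}) \<union> dep L \<Delta> x"

primrec is_formula ::
  "('k, 'l) cat \<Rightarrow> 'k set \<Rightarrow> ('k, 'l, 'v) setfctr \<Rightarrow> ('k, 'l, 'v) formula \<Rightarrow> bool" where
  "is_formula L Rels \<Delta> (Atom R xs) \<longleftrightarrow> R \<in> Rels \<and> xs \<in> matching_object L \<Delta> R"
| "is_formula L Rels \<Delta> Top \<longleftrightarrow> True"
| "is_formula L Rels \<Delta> Bot \<longleftrightarrow> True"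
| "is_formula L Rels \<Delta> (Conj \<phi> \<psi>) \<longleftrightarrow> is_formula L Rels \<Delta> \<phi> \<and> is_formula L Rels \<Delta> \<psi>"
| "is_formula L Rels \<Delta> (Disj \<phi> \<psi>) \<longleftrightarrow> is_formula L Rels \<Delta> \<phi> \<and> is_formula L Rels \<Delta> \<psi>"
| "is_formula L Rels \<Delta> (Imp \<phi> \<psi>) \<longleftrightarrow> is_formula L Rels \<Delta> \<phi> \<and> is_formula L Rels \<Delta> \<psi>"
| "is_formula L Rels \<Delta> (All K x \<phi>) \<longleftrightarrow> K \<in> Obj L \<and> x \<in> OMap \<Delta> K \<and> is_formula L Rels \<Delta> \<phi> \<and>
     (\<forall>y\<in>var L \<Delta> \<phi>. x \<notin> dep L \<Delta> y)"
| "is_formula L Rels \<Delta> (Exi K x \<phi>) \<longleftrightarrow> K \<in> Obj L \<and> x \<in> OMap \<Delta> K \<and> is_formula L Rels \<Delta> \<phi> \<and>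
     (\<forall>y\<in>var L \<Delta> \<phi>. x \<notin> dep L \<Delta> y)"

text \<open>The fibre of the matching map of \<open>M\<close> in which a variable \<open>x\<close> of kind \<open>K\<close> may take values,
  once the variables on which \<open>x\<close> depends are interpreted by \<open>\<alpha>\<close>.\<close>

definition sort_fibre ::
  "('k, 'l) cat \<Rightarrow> ('k, 'l, 'v) setfctr \<Rightarrow> ('k, 'l, 'e) setfctr \<Rightarrow> ('k \<Rightarrow> 'v \<Rightarrow> 'e) \<Rightarrow> 'k \<Rightarrow> 'v \<Rightarrow> 'e set" where
  "sort_fibre L \<Delta> M \<alpha> K x =
     {a \<in> OMap M K. matching_map L M K a = matching_trans L \<alpha> K (matching_map L \<Delta> K x)}"

definition upd :: "('k \<Rightarrow> 'v \<Rightarrow> 'e) \<Rightarrow> 'k \<Rightarrow> 'v \<Rightarrow> 'e \<Rightarrow> 'k \<Rightarrow> 'v \<Rightarrow> 'e" where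
  "upd \<alpha> K x a = \<alpha>(K := (\<alpha> K)(x := a))"

primrec sat ::
  "('k, 'l) cat \<Rightarrow> ('k, 'l, 'v) setfctr \<Rightarrow> ('k, 'l, 'e) setfctr \<Rightarrow>
   ('k, 'l, 'v) formula \<Rightarrow> ('k \<Rightarrow> 'v \<Rightarrow> 'e) \<Rightarrow> bool" where
  "sat L \<Delta> M (Atom R xs) \<alpha> \<longleftrightarrow> matching_trans L \<alpha> R xs \<in> matching_map L M R ` OMap M R"
| "sat L \<Delta> M Top \<alpha> \<longleftrightarrow> True"
| "sat L \<Delta> M Bot \<alpha> \<longleftrightarrow> False"
| "sat L \<Delta> M (Conj \<phi> \<psi>) \<alpha> \<longleftrightarrow> sat L \<Delta> M \<phi> \<alpha> \<and> sat L \<Delta> M \<psi> \<alpha>"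
| "sat L \<Delta> M (Disj \<phi> \<psi>) \<alpha> \<longleftrightarrow> sat L \<Delta> M \<phi> \<alpha> \<or> sat L \<Delta> M \<psi> \<alpha>"
| "sat L \<Delta> M (Imp \<phi> \<psi>) \<alpha> \<longleftrightarrow> (sat L \<Delta> M \<phi> \<alpha> \<longrightarrow> sat L \<Delta> M \<psi> \<alpha>)"
| "sat L \<Delta> M (All K x \<phi>) \<alpha> \<longleftrightarrow>
     (\<forall>a\<in>sort_fibre L \<Delta> M \<alpha> K x. sat L \<Delta> M \<phi> (upd \<alpha> K x a))"
| "sat L \<Delta> M (Exi K x \<phi>) \<alpha> \<longleftrightarrow>
     (\<exists>a\<in>sort_fibre L \<Delta> M \<alpha> K x. sat L \<Delta> M \<phi> (upd \<alpha> K x a))"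


definition hom_fctr ::
  "('o, 'a) cat \<Rightarrow> ('k, 'l, 'o, 'a) fctr \<Rightarrow> 'o \<Rightarrow> ('k, 'l, 'a) setfctr" where
  "hom_fctr C D X = \<lparr>OMap = (\<lambda>K. hom C (OMap D K) X), AMap = (\<lambda>p h. Comp C h (AMap D p))\<rparr>"

definition hom_trans :: "('o, 'a) cat \<Rightarrow> 'a \<Rightarrow> 'k \<Rightarrow> 'a \<Rightarrow> 'a" where
  "hom_trans C g = (\<lambda>K h. Comp C g h)"

text \<open>The right class of the Reedy weak factorization system on set-valued functors consists of the
  fiberwise surjections; the condition says that the trivial fibrations are its preimage under the
  functor taking \<open>X\<close> to \<open>hom_fctr C D X\<close>.\<close>

definition condition_triangle ::
  "('k, 'l) cat \<Rightarrow> ('o, 'a) cat \<Rightarrow> 'a set \<Rightarrow> 'a set \<Rightarrow> ('k, 'l, 'o, 'a) fctr \<Rightarrow> bool" where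
  "condition_triangle L C W Fib D \<longleftrightarrow>
     (\<forall>g\<in>Arr C. g \<in> Fib \<inter> W \<longleftrightarrow>
        fiberwise_surjective L (hom_fctr C D (Dom C g)) (hom_fctr C D (Cod C g)) (hom_trans C g))"

end

theory Submission
  imports Defs
begin

text \<open>Truth of formulae is preserved and reflected by fiberwise surjections: given an
  interpretation in the domain, every value of a quantified variable in the codomain lifts to a value
  in the corresponding fibre, and for relation symbols the same lifting reflects atomic formulae. By
  factoring \<open>X \<rightarrow> X \<times> Y\<close>, the graph of \<open>f\<close>, into a trivial cofibration followed by a fibration, one
  gets a span of trivial fibrations \<open>r : Z \<rightarrow> X\<close>, \<open>q : Z \<rightarrow> Y\<close> and a section \<open>s\<close> of \<open>r\<close> with
  \<open>q s = f\<close>. The interpretation \<open>s \<alpha>\<close> in \<open>Z\<close> is sent to \<open>\<alpha>\<close> by \<open>r\<close> and to \<open>\<beta>\<close> by \<open>q\<close>.\<close>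

section \<open>Proper arrows and matching objects of a FOLDS signature\<close>

lemma proper_arrsD:
  assumes "p \<in> proper_arrs L K"
  shows "p \<in> Arr L" "Dom L p = K" "p \<noteq> Ide L K" "p \<in> hom L K (Cod L p)"
  using assms by (auto simp: proper_arrs_def hom_def)

context folds_signature
begin

text \<open>Equal ends have equal degrees, and \<open>deg\<close> reflects identities. Hence
  updating an interpretation at kind \<open>K\<close> does not disturb its values at the codomains
  of proper arrows out of \<open>K\<close>.\<close>

lemma proper_Cod_neq:
  assumes "p \<in> proper_arrs L K"
  shows "Cod L p \<noteq> K"
  using deg_reflects_ide[of p] proper_arrsD[OF assms] by auto

lemma proper_comp:
  assumes p: "p \<in> proper_arrs L K" and q: "q \<in> Arr L" "Dom L q = Cod L p"
  shows "Comp L q p \<in> proper_arrs L K" "Cod L (Comp L q p) = Cod L q"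
proof -
  note pD = proper_arrsD[OF p]
  have "q \<in> hom L (Cod L p) (Cod L q)"
    using q by (simp add: hom_def)
  then have qp: "Comp L q p \<in> hom L K (Cod L q)"
    using pD(4) Comp_hom by blast
  moreover have "Comp L q p \<noteq> Ide L K"
  proof
    assume "Comp L q p = Ide L K"
    moreover have "Ide L K \<in> hom L K K"
      using pD(1,2) Dom_Obj Ide_hom by blast
    ultimately have "Cod L q = K"
      using qp by (simp add: hom_def)
    \<comment> \<open>Degrees fall weakly along \<open>p\<close> and then along \<open>q\<close>,
      yet end at \<open>deg K\<close> again, so neither arrow lowers the degree; \<open>p\<close>
      would then be an identity.\<close>
    then have "deg (Dom L p) = deg (Cod L p)"
      using deg_functor[OF pD(1)] deg_functor[OF q(1)] pD(2) q(2) by simp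
    then show False
      using deg_reflects_ide pD by auto
  qed
  ultimately show "Comp L q p \<in> proper_arrs L K" "Cod L (Comp L q p) = Cod L q"
    by (auto simp: hom_def proper_arrs_def)
qed

lemma matching_map_in_matching_object:
  assumes "set_functor L M" and x: "x \<in> OMap M K"
  shows "matching_map L M K x \<in> matching_object L M K"
proof -
  interpret set_functor L M by fact
  have "AMap M q (AMap M p x) = AMap M (Comp L q p) x"
    if "p \<in> proper_arrs L K" "q \<in> Arr L" "Dom L q = Cod L p" for p q
    using act_Comp[of p K "Cod L p" q "Cod L q" x] that x proper_arrsD(4)[OF that(1)]
    by (simp add: hom_def)
  then show ?thesis
    using act_in[OF proper_arrsD(4) x] proper_comp
    by (auto simp: matching_map_def matching_object_def)
qed

text \<open>Naturality at the entries of \<open>m\<close> is all that compatibility of the image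
  family uses. It is asked on \<open>V\<close> alone because \<open>V\<close> will be the free
  variables of a formula, the only place where the interpretation is controlled.\<close>

lemma matching_trans_in_matching_object:
  assumes nat: "nat_trans L (restrict_to G V) M \<alpha>"
    and m: "m \<in> matching_object L G K" "m ` proper_arrs L K \<subseteq> V"
  shows "matching_trans L \<alpha> K m \<in> matching_object L M K"
proof -
  have mp: "m p \<in> OMap (restrict_to G V) (Cod L p)" if "p \<in> proper_arrs L K" for p
    using m that by (auto simp: matching_object_def restrict_to_def)
  have "\<alpha> (Cod L p) (m p) \<in> OMap M (Cod L p)" if "p \<in> proper_arrs L K" for p
    using nat mp[OF that] Cod_Obj proper_arrsD(1)[OF that] unfolding nat_trans_def by blast
  moreover have "AMap M q (\<alpha> (Cod L p) (m p)) = \<alpha> (Cod L q) (m (Comp L q p))"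
    if p: "p \<in> proper_arrs L K" and q: "q \<in> Arr L" "Dom L q = Cod L p" for p q
  proof -
    have "AMap G q (m p) = m (Comp L q p)"
      using m(1) p q by (simp add: matching_object_def)
    moreover have "\<alpha> (Cod L q) (AMap G q (m p)) = AMap M q (\<alpha> (Cod L p) (m p))"
      using nat mp[OF p] q unfolding nat_trans_def by (auto simp: restrict_to_def)
    ultimately show ?thesis by simp
  qed
  ultimately show ?thesis
    using proper_comp by (auto simp: matching_object_def matching_trans_def)
qed

end

section \<open>Fiberwise surjections and truth of formulae\<close>

lemma fiberwise_surjective_fibre:
  assumes fs: "fiberwise_surjective L M N \<rho>" and K: "K \<in> Obj L"
    and m: "m \<in> matching_object L M K"
  shows "{b \<in> OMap N K. matching_map L N K b = matching_trans L \<rho> K m} =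
    \<rho> K ` {a \<in> OMap M K. matching_map L M K a = m}" (is "?B = ?A")
proof -
  have img: "(\<lambda>x. (\<rho> K x, matching_map L M K x)) ` OMap M K =
        {(n, m). n \<in> OMap N K \<and> m \<in> matching_object L M K \<and>
                 matching_map L N K n = matching_trans L \<rho> K m}" (is "?f ` _ = ?S")
    using fs K unfolding fiberwise_surjective_def by blast
  \<comment> \<open>Surjectivity onto the pullback is an equality of sets of pairs; slicing both
    sides at second component \<open>m\<close> compares single fibres.\<close>
  have "b \<in> ?B \<longleftrightarrow> (b, m) \<in> ?S" for b
    using m by auto
  also have "(b, m) \<in> ?S \<longleftrightarrow> b \<in> ?A" for b
    unfolding img[symmetric] by auto
  finally show ?thesis by blast
qed

text \<open>Naturality at \<open>x\<close> along proper arrows is exactly the fibre condition on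
  \<open>a\<close>. At any other \<open>y\<close> in \<open>V\<close> it is inherited from
  \<open>\<alpha>\<close>: since \<open>y\<close> does not depend on \<open>x\<close>, the update is
  not seen on the variables that \<open>y\<close> depends on. The lemma serves to pass under a
  quantifier, with \<open>V\<close> the free variables of the body.\<close>

lemma (in folds_signature) nat_trans_upd:
  assumes "context_structure L Rels \<Delta>" and "set_functor L M"
    and K: "K \<in> Obj L" and x: "x \<in> OMap \<Delta> K"
    and nodep: "\<And>y. y \<in> V \<Longrightarrow> x \<notin> dep L \<Delta> y"
    and nat: "nat_trans L (restrict_to \<Delta> ((V - {x}) \<union> dep L \<Delta> x)) M \<alpha>"
    and a: "a \<in> sort_fibre L \<Delta> M \<alpha> K x"
  shows "nat_trans L (restrict_to \<Delta> V) M (upd \<alpha> K x a)"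
proof -
  interpret \<Delta>: context_structure L Rels \<Delta> by fact
  interpret M: set_functor L M by fact
  \<comment> \<open>A variable of a context has one kind only, so updating at \<open>K\<close>
    covers every occurrence of \<open>x\<close>.\<close>
  have kind: "J = K" if "J \<in> Obj L" "x \<in> OMap \<Delta> J" for J
    using \<Delta>.disjoint_kinds K x that by blast
  have aM: "a \<in> OMap M K"
    and match: "matching_map L M K a = matching_trans L \<alpha> K (matching_map L \<Delta> K x)"
    using a by (auto simp: sort_fibre_def)
  have val: "upd \<alpha> K x a J y \<in> OMap M J" if "J \<in> Obj L" "y \<in> OMap \<Delta> J" "y \<in> V" for J y
  proof (cases "y = x")
    case True
    then show ?thesis using kind that aM by (auto simp: upd_def)
  next
    case False
    then show ?thesis using nat that by (auto simp: upd_def nat_trans_def restrict_to_def)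
  qed
  have "upd \<alpha> K x a (Cod L p) (AMap \<Delta> p y) = AMap M p (upd \<alpha> K x a (Dom L p) y)"
    if p: "p \<in> Arr L" and y: "y \<in> OMap \<Delta> (Dom L p)" "y \<in> V" for p y
  proof (cases "p = Ide L (Dom L p)")
    case True
    define J where "J = Dom L p"
    have J: "J \<in> Obj L" "p = Ide L J" "Cod L p = J" "Dom L p = J"
      using True p Dom_Obj Ide_hom[of J] by (auto simp: J_def hom_def)
    show ?thesis
      using \<Delta>.act_Ide[OF J(1)] M.act_Ide[OF J(1)] val[OF J(1)] y J by simp
  next
    case False
    then have pp: "p \<in> proper_arrs L (Dom L p)"
      using p by (simp add: proper_arrs_def)
    show ?thesis
    proof (cases "y = x")
      case True
      then have domK: "Dom L p = K"
        using kind y Dom_Obj p by auto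
      then have "AMap M p a = \<alpha> (Cod L p) (AMap \<Delta> p x)"
        using fun_cong[OF match, of p] pp
        by (simp add: matching_map_def matching_trans_def)
      then show ?thesis
        using True domK proper_Cod_neq[OF pp] by (simp add: upd_def)
    next
      case False
      have "AMap \<Delta> p y \<in> dep L \<Delta> y"
        using pp y Dom_Obj p by (auto simp: dep_def)
      then have "AMap \<Delta> p y \<noteq> x"
        using nodep y by auto
      then show ?thesis
        using False nat p y by (auto simp: upd_def nat_trans_def restrict_to_def)
    qed
  qed
  then show ?thesis
    using val by (auto simp: nat_trans_def restrict_to_def)
qed

text \<open>Composing the \<open>\<alpha>\<close>-interpretation of the boundary of \<open>x\<close>
  with \<open>\<rho>\<close> gives its \<open>\<beta>\<close>-interpretation, since the boundary
  lies in \<open>V\<close>. So admissible values of \<open>x\<close> in \<open>N\<close> lift to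
  \<open>M\<close>, and those in \<open>M\<close> map to \<open>N\<close>, which is what a
  quantifier needs.\<close>

lemma (in folds_signature) sort_fibre_fiberwise_surjective:
  assumes "set_functor L \<Delta>" and fs: "fiberwise_surjective L M N \<rho>"
    and K: "K \<in> Obj L" and x: "x \<in> OMap \<Delta> K" and V: "dep L \<Delta> x \<subseteq> V"
    and nat: "nat_trans L (restrict_to \<Delta> V) M \<alpha>"
    and compat: "\<And>J y. \<lbrakk>J \<in> Obj L; y \<in> OMap \<Delta> J; y \<in> V\<rbrakk> \<Longrightarrow> \<rho> J (\<alpha> J y) = \<beta> J y"
  shows "sort_fibre L \<Delta> N \<beta> K x = \<rho> K ` sort_fibre L \<Delta> M \<alpha> K x"
proof -
  interpret \<Delta>: set_functor L \<Delta> by fact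
  let ?m = "matching_map L \<Delta> K x"
  have inV: "AMap \<Delta> p x \<in> V" "AMap \<Delta> p x \<in> OMap \<Delta> (Cod L p)" if "p \<in> proper_arrs L K" for p
    using that V K x \<Delta>.act_in[OF proper_arrsD(4)] by (auto simp: dep_def)
  then have "?m ` proper_arrs L K \<subseteq> V"
    by (auto simp: matching_map_def)
  then have "matching_trans L \<alpha> K ?m \<in> matching_object L M K"
    using matching_trans_in_matching_object[OF nat]
      matching_map_in_matching_object[OF \<open>set_functor L \<Delta>\<close> x] by blast
  moreover have "matching_trans L \<rho> K (matching_trans L \<alpha> K ?m) = matching_trans L \<beta> K ?m"
    using compat inV Cod_Obj proper_arrsD(1)
    by (fastforce simp: matching_trans_def matching_map_def)
  ultimately show ?thesis
    using fiberwise_surjective_fibre[OF fs K, of "matching_trans L \<alpha> K ?m"]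
    unfolding sort_fibre_def by simp
qed

text \<open>Common to both quantifiers: \<open>var\<close> and \<open>is_formula\<close> have the
  same clauses for \<open>All\<close> and \<open>Exi\<close>, so the version for \<open>All\<close>
  also serves the case \<open>Exi\<close>. \<open>IH\<close> stands for the induction hypothesis on
  the body.\<close>

lemma (in folds_signature) sat_quantifier_step:
  assumes \<Delta>: "context_structure L Rels \<Delta>" and M: "set_functor L M"
    and fs: "fiberwise_surjective L M N \<rho>"
    and form: "is_formula L Rels \<Delta> (All K x \<phi>)"
    and nat: "nat_trans L (restrict_to \<Delta> (var L \<Delta> (All K x \<phi>))) M \<alpha>"
    and compat: "\<And>J y. \<lbrakk>J \<in> Obj L; y \<in> OMap \<Delta> J; y \<in> var L \<Delta> (All K x \<phi>)\<rbrakk> \<Longrightarrow>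
      \<rho> J (\<alpha> J y) = \<beta> J y"
    and IH: "\<And>\<alpha> \<beta>. \<lbrakk>is_formula L Rels \<Delta> \<phi>; nat_trans L (restrict_to \<Delta> (var L \<Delta> \<phi>)) M \<alpha>;
      \<And>J y. \<lbrakk>J \<in> Obj L; y \<in> OMap \<Delta> J; y \<in> var L \<Delta> \<phi>\<rbrakk> \<Longrightarrow> \<rho> J (\<alpha> J y) = \<beta> J y\<rbrakk> \<Longrightarrow>
      sat L \<Delta> M \<phi> \<alpha> \<longleftrightarrow> sat L \<Delta> N \<phi> \<beta>"
  shows "sort_fibre L \<Delta> N \<beta> K x = \<rho> K ` sort_fibre L \<Delta> M \<alpha> K x"
    and "a \<in> sort_fibre L \<Delta> M \<alpha> K x \<Longrightarrow>
      sat L \<Delta> M \<phi> (upd \<alpha> K x a) \<longleftrightarrow> sat L \<Delta> N \<phi> (upd \<beta> K x (\<rho> K a))"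
proof -
  interpret \<Delta>: context_structure L Rels \<Delta> by fact
  have K: "K \<in> Obj L" and x: "x \<in> OMap \<Delta> K" and \<phi>: "is_formula L Rels \<Delta> \<phi>"
    and nodep: "\<And>y. y \<in> var L \<Delta> \<phi> \<Longrightarrow> x \<notin> dep L \<Delta> y"
    using form by auto
  show "sort_fibre L \<Delta> N \<beta> K x = \<rho> K ` sort_fibre L \<Delta> M \<alpha> K x"
    by (rule sort_fibre_fiberwise_surjective[OF \<Delta>.set_functor_axioms fs K x _ nat compat]) simp_all
  assume a: "a \<in> sort_fibre L \<Delta> M \<alpha> K x"
  show "sat L \<Delta> M \<phi> (upd \<alpha> K x a) \<longleftrightarrow> sat L \<Delta> N \<phi> (upd \<beta> K x (\<rho> K a))"
  proof (rule IH[OF \<phi>])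
    show "nat_trans L (restrict_to \<Delta> (var L \<Delta> \<phi>)) M (upd \<alpha> K x a)"
      using nat_trans_upd[OF \<Delta> M K x nodep _ a] nat by simp
  next
    fix J y
    assume J: "J \<in> Obj L" and y: "y \<in> OMap \<Delta> J" "y \<in> var L \<Delta> \<phi>"
    show "\<rho> J (upd \<alpha> K x a J y) = upd \<beta> K x (\<rho> K a) J y"
    proof (cases "y = x")
      case True
      then have "J = K"
        using \<Delta>.disjoint_kinds[OF J K] x y by blast
      then show ?thesis
        using True by (simp add: upd_def)
    next
      case False
      then show ?thesis
        using compat[OF J y(1)] y(2) by (auto simp: upd_def)
    qed
  qed
qed

lemma nat_trans_restrict_to_Un:
  "nat_trans L (restrict_to G (V \<union> V')) M \<alpha> \<longleftrightarrow>
     nat_trans L (restrict_to G V) M \<alpha> \<and> nat_trans L (restrict_to G V') M \<alpha>"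
  by (auto simp: nat_trans_def restrict_to_def)

text \<open>Naturality and agreement are asked on the free variables only, because bound variables
  may lie outside the context being interpreted. The induction generalizes \<open>\<alpha>\<close>
  and \<open>\<beta>\<close>, which quantifiers update.\<close>

lemma (in folds_signature) sat_fiberwise_surjective:
  assumes \<Delta>: "context_structure L Rels \<Delta>" and M: "set_functor L M"
    and fs: "fiberwise_surjective L M N \<rho>"
    and "is_formula L Rels \<Delta> \<phi>"
    and "nat_trans L (restrict_to \<Delta> (var L \<Delta> \<phi>)) M \<alpha>"
    and "\<And>J y. \<lbrakk>J \<in> Obj L; y \<in> OMap \<Delta> J; y \<in> var L \<Delta> \<phi>\<rbrakk> \<Longrightarrow> \<rho> J (\<alpha> J y) = \<beta> J y"
  shows "sat L \<Delta> M \<phi> \<alpha> \<longleftrightarrow> sat L \<Delta> N \<phi> \<beta>"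
  using assms(4-)
proof (induction \<phi> arbitrary: \<alpha> \<beta>)
  case (Atom R xs)
  then have R: "R \<in> Obj L" and xs: "xs \<in> matching_object L \<Delta> R"
    using Rels_Obj by auto
  have "matching_trans L \<alpha> R xs \<in> matching_object L M R"
    using matching_trans_in_matching_object[OF Atom.prems(2) xs] by simp
  \<comment> \<open>An atom holds iff the fibre over its interpreted family is nonempty; the fibre
    in \<open>N\<close> is the image of that in \<open>M\<close>, so both are empty or neither
    is.\<close>
  note fib = fiberwise_surjective_fibre[OF fs R this]
  have "matching_trans L \<rho> R (matching_trans L \<alpha> R xs) = matching_trans L \<beta> R xs"
    using Atom.prems(3) xs Cod_Obj proper_arrsD(1)
    by (fastforce simp: matching_trans_def matching_object_def)
  with fib show ?case
    by (auto simp: image_iff set_eq_iff eq_commute)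
next
  case (All K x \<phi>)
  note step = sat_quantifier_step[OF \<Delta> M fs, of K x \<phi> \<alpha> \<beta>]
  have "sort_fibre L \<Delta> N \<beta> K x = \<rho> K ` sort_fibre L \<Delta> M \<alpha> K x"
    and "\<And>a. a \<in> sort_fibre L \<Delta> M \<alpha> K x \<Longrightarrow>
      sat L \<Delta> M \<phi> (upd \<alpha> K x a) \<longleftrightarrow> sat L \<Delta> N \<phi> (upd \<beta> K x (\<rho> K a))"
    using step All by simp_all
  then show ?case by simp
next
  case (Exi K x \<phi>)
  note step = sat_quantifier_step[OF \<Delta> M fs, of K x \<phi> \<alpha> \<beta>]
  have "sort_fibre L \<Delta> N \<beta> K x = \<rho> K ` sort_fibre L \<Delta> M \<alpha> K x"
    and "\<And>a. a \<in> sort_fibre L \<Delta> M \<alpha> K x \<Longrightarrow>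
      sat L \<Delta> M \<phi> (upd \<alpha> K x a) \<longleftrightarrow> sat L \<Delta> N \<phi> (upd \<beta> K x (\<rho> K a))"
    using step Exi by simp_all
  then show ?case by simp
qed (simp_all add: nat_trans_restrict_to_Un)

lemma nat_trans_subfunctor:
  assumes "subfunctor L M N" and "nat_trans L N P \<alpha>" and "category L"
  shows "nat_trans L M P \<alpha>"
proof -
  interpret category L by fact
  show ?thesis
    using assms(1,2) Dom_Obj unfolding nat_trans_def subfunctor_def
    by (simp add: Pi_iff subset_iff)
qed

section \<open>Binary products\<close>

definition binary_product :: "('o, 'a) cat \<Rightarrow> 'o \<Rightarrow> 'o \<Rightarrow> 'o \<Rightarrow> 'a \<Rightarrow> 'a \<Rightarrow> bool" where
  "binary_product C X Y P a b \<longleftrightarrow> a \<in> hom C P X \<and> b \<in> hom C P Y \<and>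
     (\<forall>Q. \<forall>u\<in>hom C Q X. \<forall>v\<in>hom C Q Y. \<exists>!w. w \<in> hom C Q P \<and> Comp C a w = u \<and> Comp C b w = v)"

text \<open>A product is a limit over a discrete category with two objects. Infinity of
  \<open>'u\<close> supplies two distinct objects and makes a two-element set small.\<close>

lemma (in category) ex_binary_product:
  fixes U :: "'u itself"
  assumes "complete U C" and "infinite (UNIV :: 'u set)" and X: "X \<in> Obj C" and Y: "Y \<in> Obj C"
  shows "\<exists>P a b. binary_product C X Y P a b"
proof -
  obtain j k :: 'u where jk: "j \<noteq> k"
    using ex_new_if_finite[OF assms(2), of "{undefined}"] by auto
  \<comment> \<open>Each object serves as its own identity arrow; composable arrows coincide, so
    composition may return either one.\<close>
  define J where "J = \<lparr>Obj = {j, k}, Arr = {j, k}, Dom = id, Cod = id, Ide = id, Comp = (\<lambda>g f. f)\<rparr>"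
  define F where "F = \<lparr>OMap = (\<lambda>i. if i = j then X else Y),
    AMap = (\<lambda>i. Ide C (if i = j then X else Y))\<rparr>"
  have "category J"
    by unfold_locales (auto simp: J_def hom_def)
  moreover have "|{j, k}| <o |UNIV :: 'u set|"
    by (rule finite_ordLess_infinite[OF card_of_Well_order card_of_Well_order])
      (simp_all add: Field_card_of assms(2))
  ultimately have small: "small_category J"
    by (simp add: small_category_def J_def)
  have ftr: "is_functor J C F"
    using X Y Ide_hom Comp_Ide[OF Ide_hom]
    by unfold_locales (auto simp: J_def F_def hom_def)
  obtain P c where lim: "limit_cone J C F P c"
    using assms(1) small ftr unfolding complete_def by blast
  \<comment> \<open>All arrows of \<open>J\<close> are identities, so the commutation condition of a
    cone is automatic.\<close>
  have cone_iff: "cone J C F Q d \<longleftrightarrow> Q \<in> Obj C \<and> d j \<in> hom C Q X \<and> d k \<in> hom C Q Y" for Q d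
    using jk Ide_Comp by (auto simp: cone_def J_def F_def)
  have "\<exists>!w. w \<in> hom C Q P \<and> Comp C (c j) w = u \<and> Comp C (c k) w = v"
    if u: "u \<in> hom C Q X" and v: "v \<in> hom C Q Y" for Q u v
  proof -
    have "Q \<in> Obj C"
      using u Dom_Obj by (auto simp: hom_def)
    then have "cone J C F Q (\<lambda>i. if i = j then u else v)"
      using u v jk by (simp add: cone_iff)
    then have "\<exists>!w. w \<in> hom C Q P \<and> (\<forall>i\<in>Obj J. Comp C (c i) w = (if i = j then u else v))"
      using lim unfolding limit_cone_def by blast
    then show ?thesis
      using jk by (simp add: J_def)
  qed
  moreover have "c j \<in> hom C P X" "c k \<in> hom C P Y"
    using lim cone_iff by (auto simp: limit_cone_def)
  ultimately show ?thesis
    unfolding binary_product_def by blast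
qed

lemma binary_product_swap:
  assumes "binary_product C X Y P a b"
  shows "binary_product C Y X P b a"
proof -
  have "\<exists>!w. w \<in> hom C Q P \<and> Comp C b w = u \<and> Comp C a w = v"
    if "u \<in> hom C Q Y" "v \<in> hom C Q X" for Q u v
    using assms that unfolding binary_product_def by (subst conj_commute[of "_ = u"]) blast
  then show ?thesis
    using assms unfolding binary_product_def by blast
qed

section \<open>Lifting against composites and product projections\<close>

lemma (in category) lifts_comp:
  assumes i: "i \<in> Arr C" and p: "p \<in> hom C X Y" and q: "q \<in> hom C Y Z"
    and lp: "lifts C i p" and lq: "lifts C i q"
  shows "lifts C i (Comp C q p)"
  unfolding lifts_def
proof (intro ballI impI)
  fix u v
  assume "u \<in> hom C (Dom C i) (Dom C (Comp C q p))" "v \<in> hom C (Cod C i) (Cod C (Comp C q p))"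
    and sq: "Comp C (Comp C q p) u = Comp C v i"
  moreover have qp: "Comp C q p \<in> hom C X Z"
    using Comp_hom p q by blast
  ultimately have u: "u \<in> hom C (Dom C i) X" and v: "v \<in> hom C (Cod C i) Z"
    by (auto simp: hom_def)
  have ends: "Dom C p = X" "Cod C p = Y" "Dom C q = Y" "Cod C q = Z"
    using p q by (auto simp: hom_def)
  have pu: "Comp C p u \<in> hom C (Dom C i) Y"
    using Comp_hom u p by blast
  \<comment> \<open>Two lifts in succession: \<open>v\<close> is lifted through \<open>q\<close>
    with top edge \<open>p u\<close>, and the resulting \<open>h\<close> is then lifted through
    \<open>p\<close> with top edge \<open>u\<close>.\<close>
  have "Comp C q (Comp C p u) = Comp C v i"
    using Comp_assoc[OF u p q] sq by simp
  then obtain h where h: "h \<in> hom C (Cod C i) Y" "Comp C h i = Comp C p u" "Comp C q h = v"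
    using lq pu v ends unfolding lifts_def by metis
  obtain g where g: "g \<in> hom C (Cod C i) X" "Comp C g i = u" "Comp C p g = h"
    using lp u h(1,2) ends unfolding lifts_def by metis
  have "Comp C (Comp C q p) g = v"
    using Comp_assoc[OF g(1) p q] g(3) h(3) by simp
  then show "\<exists>h\<in>hom C (Cod C i) (Dom C (Comp C q p)). Comp C h i = u \<and> Comp C (Comp C q p) h = v"
    using g qp by (auto simp: hom_def)
qed

text \<open>The projection to \<open>X\<close> is the base change of \<open>t\<close> along
  \<open>X \<rightarrow> T\<close>, and right lifting properties survive base change. Concretely, a
  lift of the component \<open>b u\<close> against \<open>t\<close> is paired with
  \<open>v\<close>.\<close>

lemma (in category) lifts_product_projection:
  assumes prod: "binary_product C X Y P a b" and T: "terminal C T" "t \<in> hom C Y T"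
    and i: "i \<in> Arr C" and lt: "lifts C i t"
  shows "lifts C i a"
  unfolding lifts_def
proof (intro ballI impI)
  fix u v
  have a: "a \<in> hom C P X" and b: "b \<in> hom C P Y"
    using prod by (auto simp: binary_product_def)
  have i': "i \<in> hom C (Dom C i) (Cod C i)"
    using i by (simp add: hom_def)
  assume "u \<in> hom C (Dom C i) (Dom C a)" "v \<in> hom C (Cod C i) (Cod C a)"
    and sq: "Comp C a u = Comp C v i"
  then have u: "u \<in> hom C (Dom C i) P" and v: "v \<in> hom C (Cod C i) X"
    using a by (auto simp: hom_def)
  have bu: "Comp C b u \<in> hom C (Dom C i) Y"
    using Comp_hom u b by blast
  \<comment> \<open>This is the bottom edge of the square against \<open>t\<close>, which commutes
    because maps into \<open>T\<close> are unique.\<close>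
  obtain w where w: "w \<in> hom C (Cod C i) T"
    using T(1) i Cod_Obj unfolding terminal_def by blast
  have "Comp C t (Comp C b u) \<in> hom C (Dom C i) T" "Comp C w i \<in> hom C (Dom C i) T"
    using Comp_hom bu T(2) w i' by blast+
  then have "Comp C t (Comp C b u) = Comp C w i"
    using T(1) i Dom_Obj unfolding terminal_def by blast
  moreover have "Dom C t = Y" "Cod C t = T"
    using T(2) by (auto simp: hom_def)
  ultimately obtain h where h: "h \<in> hom C (Cod C i) Y" "Comp C h i = Comp C b u"
    using lt bu w unfolding lifts_def by metis
  obtain g where g: "g \<in> hom C (Cod C i) P" "Comp C a g = v" "Comp C b g = h"
    using prod v h(1) unfolding binary_product_def by metis
  have gi: "Comp C g i \<in> hom C (Dom C i) P"
    using Comp_hom i' g(1) by blast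
  moreover have "Comp C a (Comp C g i) = Comp C a u" "Comp C b (Comp C g i) = Comp C b u"
    using Comp_assoc[OF i' g(1) a] Comp_assoc[OF i' g(1) b] g sq h by auto
  moreover have "Comp C a u \<in> hom C (Dom C i) X"
    using Comp_hom u a by blast
  \<comment> \<open>Both maps into the product have the same two components.\<close>
  ultimately have "Comp C g i = u"
    using prod u bu unfolding binary_product_def by metis
  then show "\<exists>h\<in>hom C (Cod C i) (Dom C a). Comp C h i = u \<and> Comp C a h = v"
    using g a by (auto simp: hom_def)
qed

section \<open>Fibrations and the span of trivial fibrations\<close>

context model_category
begin

lemma Fib_iff: "p \<in> Fib \<longleftrightarrow> p \<in> Arr C \<and> (\<forall>i\<in>Cof \<inter> W. lifts C i p)"
  using weak_factorization_system.right_class[OF wfs_trivcof_fib] by blast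

lemma Cof_W_Arr: "i \<in> Cof \<inter> W \<Longrightarrow> i \<in> Arr C"
  using W_Arr by blast

lemma Fib_comp:
  assumes "p \<in> hom C X Y" "q \<in> hom C Y Z" "p \<in> Fib" "q \<in> Fib"
  shows "Comp C q p \<in> Fib"
  using assms lifts_comp[OF Cof_W_Arr assms(1,2)] Comp_hom[OF assms(1,2)]
  by (auto simp: Fib_iff hom_def)

lemma product_projection_Fib:
  assumes "binary_product C X Y P a b" and "fibrant C Fib Y"
  shows "a \<in> Fib"
  using assms lifts_product_projection[OF assms(1)] Cof_W_Arr
  by (auto simp: Fib_iff fibrant_def binary_product_def hom_def)

text \<open>Identities are not put into \<open>W\<close> by an axiom; cancelling \<open>f\<close>
  from \<open>f = f \<circ> id\<close> yields this one.\<close>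

lemma Ide_in_W:
  assumes "X \<in> Obj C" "f \<in> hom C X Y" "f \<in> W"
  shows "Ide C X \<in> W"
  using W_cancel_left[OF Ide_hom[OF assms(1)] assms(2,3)] Comp_Ide assms by simp

lemma span_of_trivial_fibrations:
  assumes inf: "infinite (UNIV :: 'u set)"
    and f: "f \<in> hom C X Y" "f \<in> W" and fib: "fibrant C Fib X" "fibrant C Fib Y"
  obtains Z s r q where "s \<in> hom C X Z" "r \<in> hom C Z X" "q \<in> hom C Z Y"
    "r \<in> Fib \<inter> W" "q \<in> Fib \<inter> W" "Comp C r s = Ide C X" "Comp C q s = f"
proof -
  have X: "X \<in> Obj C" and Y: "Y \<in> Obj C"
    using f(1) Dom_Obj Cod_Obj by (auto simp: hom_def)
  obtain P a b where prod: "binary_product C X Y P a b"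
    using ex_binary_product[OF complete inf X Y] by blast
  then have a: "a \<in> hom C P X" and b: "b \<in> hom C P Y"
    by (auto simp: binary_product_def)
  \<comment> \<open>\<open>g\<close> is the graph of \<open>f\<close>.\<close>
  obtain g where g: "g \<in> hom C X P" "Comp C a g = Ide C X" "Comp C b g = f"
    using prod Ide_hom[OF X] f(1) unfolding binary_product_def by metis
  obtain s e where se: "s \<in> Cof \<inter> W" "e \<in> Fib" "Cod C s = Dom C e" "g = Comp C e s"
    using weak_factorization_system.factorization[OF wfs_trivcof_fib, of g] g(1)
    by (auto simp: hom_def)
  define Z where "Z = Dom C e"
  have "s \<in> hom C (Dom C s) Z" "e \<in> hom C Z (Cod C e)"
    using se Cof_W_Arr by (auto simp: hom_def Z_def Fib_iff)
  then have s: "s \<in> hom C X Z" and e: "e \<in> hom C Z P"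
    using Comp_hom[of s _ Z e] se(4) g(1) by (auto simp: hom_def)
  let ?r = "Comp C a e" and ?q = "Comp C b e"
  have r: "?r \<in> hom C Z X" and q: "?q \<in> hom C Z Y"
    using Comp_hom e a b by blast+
  have rs: "Comp C ?r s = Ide C X" and qs: "Comp C ?q s = f"
    using Comp_assoc[OF s e a] Comp_assoc[OF s e b] se(4) g by auto
  \<comment> \<open>Two out of three: \<open>s\<close>, the identity \<open>r s\<close> and
    \<open>f = q s\<close> are all weak equivalences.\<close>
  have "?r \<in> W" "?q \<in> W"
    using W_cancel_right[OF s r] W_cancel_right[OF s q] rs qs se(1) f Ide_in_W[OF X f] by auto
  \<comment> \<open>Each projection is a fibration because the other factor is fibrant, and
    \<open>e\<close> is a fibration.\<close>
  moreover have "?r \<in> Fib" "?q \<in> Fib"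
    using Fib_comp[OF e a se(2)] Fib_comp[OF e b se(2)] product_projection_Fib[OF prod fib(2)]
      product_projection_Fib[OF binary_product_swap[OF prod] fib(1)] by blast+
  ultimately show thesis
    using that[OF s r q] rs qs by blast
qed

end

section \<open>Transfer of truth along the span\<close>

theorem theorem7p9:
  fixes L :: "('k, 'l) cat" and deg :: "'k \<Rightarrow> nat" and Rels :: "'k set"
    and C :: "('o, 'a) cat" and U :: "'u itself" and W Cof Fib :: "'a set"
    and D :: "('k, 'l, 'o, 'a) fctr"
    and \<Gamma> \<Delta> :: "('k, 'l, 'v) setfctr" and \<alpha> \<beta> :: "'k \<Rightarrow> 'v \<Rightarrow> 'a"
    and \<phi> :: "('k, 'l, 'v) formula"
  assumes signature: "folds_signature L deg Rels"
    and universe: "infinite (UNIV :: 'u set)"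
    and model: "model_category C U W Cof Fib"
    and diagram: "is_functor (op_cat L) C D"
    and triangle: "condition_triangle L C W Fib D"
    and structures: "\<And>Z. Z \<in> Obj C \<Longrightarrow> L_structure L Rels (hom_fctr C D Z)"
    and f: "f \<in> hom C X Y" "f \<in> W"
    and fibrant: "fibrant C Fib X" "fibrant C Fib Y"
    and \<Gamma>: "context_structure L Rels \<Gamma>"
    and \<alpha>: "nat_trans L \<Gamma> (hom_fctr C D X) \<alpha>"
    and \<beta>: "nat_trans L \<Gamma> (hom_fctr C D Y) \<beta>"
    and compatible: "\<And>K x. \<lbrakk>K \<in> Obj L; x \<in> OMap \<Gamma> K\<rbrakk> \<Longrightarrow> hom_trans C f K (\<alpha> K x) = \<beta> K x"
    and \<Delta>: "context_structure L Rels \<Delta>"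
    and formula: "is_formula L Rels \<Delta> \<phi>"
    and var: "subfunctor L (restrict_to \<Delta> (var L \<Delta> \<phi>)) \<Gamma>"
  shows "sat L \<Delta> (hom_fctr C D X) \<phi> \<alpha> \<longleftrightarrow> sat L \<Delta> (hom_fctr C D Y) \<phi> \<beta>"
proof -
  interpret folds_signature L deg Rels by fact
  interpret C: model_category C U W Cof Fib by fact
  obtain Z s r q where s: "s \<in> hom C X Z" and r: "r \<in> hom C Z X" and q: "q \<in> hom C Z Y"
    and triv: "r \<in> Fib \<inter> W" "q \<in> Fib \<inter> W" and rs: "Comp C r s = Ide C X" and qs: "Comp C q s = f"
    using C.span_of_trivial_fibrations[OF universe f fibrant] .
  let ?H = "hom_fctr C D"
  let ?V = "restrict_to \<Delta> (var L \<Delta> \<phi>)"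
  define \<gamma> where "\<gamma> K x = Comp C s (\<alpha> K x)" for K x
  have Z: "Z \<in> Obj C"
    using s C.Cod_Obj by (auto simp: hom_def)
  \<comment> \<open>The variables of \<open>\<phi>\<close> come from \<open>\<Delta>\<close>, while
    \<open>\<alpha>\<close> is natural on \<open>\<Gamma>\<close>; by \<open>var\<close> the two
    contexts agree on the free variables.\<close>
  have \<alpha>V: "nat_trans L ?V (?H X) \<alpha>"
    using nat_trans_subfunctor[OF var \<alpha>] category_axioms .
  have \<alpha>_hom: "\<alpha> K x \<in> hom C (OMap D K) X" if "K \<in> Obj L" "x \<in> OMap ?V K" for K x
    using \<alpha>V that by (auto simp: nat_trans_def hom_fctr_def)
  have D_hom: "AMap D p \<in> hom C (OMap D (Cod L p)) (OMap D (Dom L p))" if "p \<in> Arr L" for p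
    using is_functor.AMap_hom[OF diagram, of p] that by (simp add: op_cat_def hom_def)
  have \<gamma>: "nat_trans L ?V (?H Z) \<gamma>"
    unfolding nat_trans_def
  proof (intro conjI ballI)
    fix K assume "K \<in> Obj L"
    then show "\<gamma> K \<in> OMap ?V K \<rightarrow> OMap (?H Z) K"
      using C.Comp_hom[OF \<alpha>_hom s] by (auto simp: \<gamma>_def hom_fctr_def)
  next
    fix p x assume p: "p \<in> Arr L" and x: "x \<in> OMap ?V (Dom L p)"
    have "\<alpha> (Cod L p) (AMap ?V p x) = Comp C (\<alpha> (Dom L p) x) (AMap D p)"
      using \<alpha>V p x by (auto simp: nat_trans_def hom_fctr_def)
    then show "\<gamma> (Cod L p) (AMap ?V p x) = AMap (?H Z) p (\<gamma> (Dom L p) x)"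
      using C.Comp_assoc[OF D_hom[OF p] \<alpha>_hom[OF Dom_Obj[OF p] x] s]
      by (simp add: \<gamma>_def hom_fctr_def)
  qed
  \<comment> \<open>Condition triangle enters here, turning both legs of the span into fiberwise
    surjections.\<close>
  have fs: "fiberwise_surjective L (?H Z) (?H X) (hom_trans C r)"
    "fiberwise_surjective L (?H Z) (?H Y) (hom_trans C q)"
    using triangle triv r q unfolding condition_triangle_def by (auto simp: hom_def)
  have sf: "set_functor L (?H Z)"
    using structures[OF Z] by (simp add: L_structure_def)
  \<comment> \<open>By associativity, \<open>r (s \<alpha>) = (r s) \<alpha> = \<alpha>\<close> and
    \<open>q (s \<alpha>) = f \<alpha> = \<beta>\<close>, the last equality holding because
    \<open>x\<close> lies in \<open>\<Gamma>\<close>.\<close>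
  have r\<gamma>: "hom_trans C r K (\<gamma> K x) = \<alpha> K x"
    and q\<gamma>: "hom_trans C q K (\<gamma> K x) = \<beta> K x"
    if "K \<in> Obj L" "x \<in> OMap \<Delta> K" "x \<in> var L \<Delta> \<phi>" for K x
  proof -
    have x: "x \<in> OMap ?V K"
      using that by (simp add: restrict_to_def)
    then have "x \<in> OMap \<Gamma> K"
      using var that(1) by (auto simp: subfunctor_def)
    then show "hom_trans C r K (\<gamma> K x) = \<alpha> K x" "hom_trans C q K (\<gamma> K x) = \<beta> K x"
      using C.Comp_assoc[OF \<alpha>_hom[OF that(1) x] s r] C.Comp_assoc[OF \<alpha>_hom[OF that(1) x] s q]
        C.Ide_Comp[OF \<alpha>_hom[OF that(1) x]] compatible[OF that(1)] rs qs
      by (auto simp: hom_trans_def \<gamma>_def)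
  qed
  have "sat L \<Delta> (?H Z) \<phi> \<gamma> \<longleftrightarrow> sat L \<Delta> (?H X) \<phi> \<alpha>"
    by (rule sat_fiberwise_surjective[OF \<Delta> sf fs(1) formula \<gamma> r\<gamma>])
  moreover have "sat L \<Delta> (?H Z) \<phi> \<gamma> \<longleftrightarrow> sat L \<Delta> (?H Y) \<phi> \<beta>"
    by (rule sat_fiberwise_surjective[OF \<Delta> sf fs(2) formula \<gamma> q\<gamma>])
  ultimately show ?thesis by blast
qed

end
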